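(* Let $D$ be a positive integer. If $G$ is a graph with $\mathrm{mad}(G)<4$ and $\Delta(G)\le D$, then $\omega(G^2)\le \frac52 D+532$.
   Context: The maximum average degree of $G$ is $\mathrm{mad}(G)=\max_{H\subseteq G} 2|E(H)|/|V(H)|$ over nonempty subgraphs $H$. The square $G^2$ of $G$ is obtained from $G$ by adding an edge between every pair of vertices at distance 2 in $G$. $\omega(\cdot)$ denotes clique number and $\Delta(\cdot)$ maximum degree. *)

theory Defs
  imports Main "HOL-Library.Disjoint_Sets" Complex_Main
begin

definition graph :: "'a set \<Rightarrow> 'a set set \<Rightarrow> bool" where
  "graph V E \<longleftrightarrow> finite V \<and> (\<forall>e\<in>E. e \<subseteq> V \<and> card e = 2)"

definition degree :: "'a set set \<Rightarrow> 'a \<Rightarrow> nat" where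
  "degree E v = card {e\<in>E. v \<in> e}"

definition max_degree :: "'a set \<Rightarrow> 'a set set \<Rightarrow> nat" where
  "max_degree V E = (if V = {} then 0 else Max (degree E ` V))"

definition mad :: "'a set \<Rightarrow> 'a set set \<Rightarrow> real" where
  "mad V E = (if V = {} then 0 else
     Max {2 * real (card F) / real (card S) | S F.
            S \<subseteq> V \<and> S \<noteq> {} \<and> F \<subseteq> E \<and> (\<forall>e\<in>F. e \<subseteq> S)})"

definition square_edges :: "'a set \<Rightarrow> 'a set set \<Rightarrow> 'a set set" where
  "square_edges V E = {{u, v} | u v. u \<in> V \<and> v \<in> V \<and> u \<noteq> v \<and>
       ({u, v} \<in> E \<or> (\<exists>w\<in>V. {u, w} \<in> E \<and> {w, v} \<in> E))}"

definition is_clique :: "'a set \<Rightarrow> 'a set set \<Rightarrow> 'a set \<Rightarrow> bool" where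
  "is_clique V E K \<longleftrightarrow> K \<subseteq> V \<and> (\<forall>u\<in>K. \<forall>v\<in>K. u \<noteq> v \<longrightarrow> {u, v} \<in> E)"

definition clique_number :: "'a set \<Rightarrow> 'a set set \<Rightarrow> nat" where
  "clique_number V E = Max (card ` {K. is_clique V E K})"

end

theory Submission
  imports Defs
begin

text \<open>
  Since every vertex set \<open>S\<close> spans fewer than \<open>2 |S|\<close> edges, the graph has an orientation with all
  out-degrees at most 2. Two vertices of a clique \<open>K\<close> of the square with disjoint out-neighbourhoods
  are either both out-neighbours of a third vertex, which happens at most \<open>D\<close> times per vertex, or
  one is reached from the other by a directed path of length at most 2. Each vertex starts at most
  6 such paths, so few vertices receive many of them. Let \<open>X\<close> be a smallest set outside of which
  every vertex receives only boundedly many. The out-neighbourhoods of the vertices of \<open>K - X\<close> are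
  the edges of a multigraph with maximum degree about \<open>D\<close> in which every edge is disjoint from about
  \<open>D\<close> others. It has boundedly many vertices, because each has degree linear in \<open>D\<close>. Hence \<open>K - X\<close>
  starts directed paths to boundedly many vertices only, and minimality of \<open>X\<close> bounds \<open>|X|\<close>
  by a constant. Finally a multigraph with maximum degree \<open>B\<close> in which every edge is
  disjoint from at most \<open>B\<close> edges has at most \<open>5 B / 2\<close> edges; the blown-up \<open>C\<^sub>5\<close> and \<open>K\<^sub>6\<close> are tight.
\<close>

section \<open>Hall's theorem with capacities\<close>

lemma card_UN_le_mult:
  assumes "finite I" "\<And>i. i \<in> I \<Longrightarrow> card (A i) \<le> c"
  shows "card (\<Union>i\<in>I. A i) \<le> c * card I"
proof -
  have "card (\<Union>i\<in>I. A i) \<le> (\<Sum>i\<in>I. card (A i))"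
    by (rule card_UN_le[OF assms(1)])
  also have "\<dots> \<le> (\<Sum>i\<in>I. c)"
    using assms(2) by (rule sum_mono)
  finally show ?thesis by (simp add: mult.commute)
qed

text \<open>
  Rado's proof of Hall's theorem: as long as some \<open>A i\<close> has two elements, submodularity of
  \<open>J \<mapsto> |\<Union>(A ` J)|\<close> allows one of them to be removed.
\<close>
lemma capacitated_representatives:
  fixes A :: "'b \<Rightarrow> 'a set"
  assumes "finite I" "\<And>i. i \<in> I \<Longrightarrow> finite (A i)"
    and "\<And>J. J \<subseteq> I \<Longrightarrow> card J \<le> k * card (\<Union>(A ` J))"
  shows "\<exists>f. (\<forall>i\<in>I. f i \<in> A i) \<and> (\<forall>x. card {i\<in>I. f i = x} \<le> k)"
  using assms(2,3)
proof (induction "\<Sum>i\<in>I. card (A i)" arbitrary: A rule: less_induct)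
  case less
  have ne: "A i \<noteq> {}" if "i \<in> I" for i
    using less.prems(2)[of "{i}"] that by auto
  show ?case
  proof (cases "\<exists>i\<in>I. \<exists>x\<in>A i. \<exists>y\<in>A i. x \<noteq> y")
    case False
    define f where "f i = (SOME x. x \<in> A i)" for i
    have f: "f i \<in> A i" if "i \<in> I" for i
      unfolding f_def using ne[OF that] by (simp add: some_in_eq)
    have "card {i\<in>I. f i = x} \<le> k" for x
    proof -
      have "\<Union>(A ` {i\<in>I. f i = x}) \<subseteq> {x}"
        using False f by blast
      then have "card (\<Union>(A ` {i\<in>I. f i = x})) \<le> 1"
        using card_mono[of "{x}"] by simp
      then have "k * card (\<Union>(A ` {i\<in>I. f i = x})) \<le> k"
        using mult_le_mono2[of _ 1 k] by simp
      moreover have "card {i\<in>I. f i = x} \<le> k * card (\<Union>(A ` {i\<in>I. f i = x}))"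
        by (rule less.prems(2)) auto
      ultimately show ?thesis by (rule order_trans[rotated])
    qed
    with f show ?thesis by blast
  next
    case True
    then obtain i x y where i: "i \<in> I" "x \<in> A i" "y \<in> A i" "x \<noteq> y" by blast
    define B where "B z = A(i := A i - {z})" for z
    \<comment> \<open>A set \<open>J\<close> violating Hall's condition after the removal of
      \<open>z\<close> must contain \<open>i\<close>; dropping \<open>i\<close> from
      \<open>J\<close> weakens the strict inequality to \<open>\<le>\<close>.\<close>
    have tight: "\<exists>F. F \<subseteq> I - {i} \<and> k * card (\<Union>(A ` F) \<union> (A i - {z})) \<le> card F"
      if z: "z \<in> A i" and noSDR: "\<not> (\<exists>f. (\<forall>i\<in>I. f i \<in> A i) \<and> (\<forall>x. card {i\<in>I. f i = x} \<le> k))" for z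
    proof -
      have "(\<Sum>j\<in>I. card (B z j)) < (\<Sum>j\<in>I. card (A j))"
      proof (rule sum_strict_mono_ex1[OF assms(1)])
        show "\<forall>j\<in>I. card (B z j) \<le> card (A j)"
          using less.prems(1) by (auto simp: B_def intro: card_mono)
        show "\<exists>j\<in>I. card (B z j) < card (A j)"
          using i(1) card_Diff1_less[OF less.prems(1)[OF i(1)] z]
          by (intro bexI[of _ i]) (auto simp: B_def)
      qed
      note IH = less.hyps[OF this]
      have "\<not> (\<forall>J\<subseteq>I. card J \<le> k * card (\<Union>(B z ` J)))"
      proof
        assume hall: "\<forall>J\<subseteq>I. card J \<le> k * card (\<Union>(B z ` J))"
        have "\<exists>f. (\<forall>j\<in>I. f j \<in> B z j) \<and> (\<forall>x. card {i\<in>I. f i = x} \<le> k)"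
        proof (rule IH)
          show "finite (B z j)" if "j \<in> I" for j
            using less.prems(1) that by (auto simp: B_def)
        qed (use hall in blast)
        moreover have "B z j \<subseteq> A j" for j by (simp add: B_def)
        ultimately show False using noSDR by blast
      qed
      then obtain J where J: "J \<subseteq> I" "card J > k * card (\<Union>(B z ` J))"
        unfolding not_all not_imp not_le by blast
      have "i \<in> J"
      proof (rule ccontr)
        assume "i \<notin> J"
        then have "B z ` J = A ` J" by (intro image_cong) (auto simp: B_def)
        with J less.prems(2)[OF J(1)] show False by simp
      qed
      have "\<Union>(B z ` J) = \<Union>(A ` (J - {i})) \<union> (A i - {z})"
        using \<open>i \<in> J\<close> by (auto simp: B_def split: if_splits)
      moreover have "card (J - {i}) = card J - 1"
        using \<open>i \<in> J\<close> by simp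
      ultimately show ?thesis
        using J by (intro exI[of _ "J - {i}"]) auto
    qed
    show ?thesis
    proof (rule ccontr)
      assume no: "\<not> ?thesis"
      from tight[OF i(2) no] obtain F where F: "F \<subseteq> I - {i}"
        "k * card (\<Union>(A ` F) \<union> (A i - {x})) \<le> card F" by blast
      from tight[OF i(3) no] obtain G where G: "G \<subseteq> I - {i}"
        "k * card (\<Union>(A ` G) \<union> (A i - {y})) \<le> card G" by blast
      define P where "P = \<Union>(A ` F) \<union> (A i - {x})"
      define Q where "Q = \<Union>(A ` G) \<union> (A i - {y})"
      have finFG: "finite F" "finite G"
        using F(1) G(1) assms(1) by (meson finite_Diff finite_subset)+
      have fin: "finite P" "finite Q"
        unfolding P_def Q_def using F(1) G(1) finFG less.prems(1) i(1) by auto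
      have "insert i (F \<union> G) \<subseteq> I" using F(1) G(1) i(1) by auto
      from less.prems(2)[OF this]
      have "card (insert i (F \<union> G)) \<le> k * card (\<Union>(A ` insert i (F \<union> G)))" .
      \<comment> \<open>As \<open>x \<noteq> y\<close>, the two truncated sets together restore
        \<open>A i\<close>. The extra 1 below counts \<open>i\<close>, which is in neither
        \<open>F\<close> nor \<open>G\<close>.\<close>
      also have "\<Union>(A ` insert i (F \<union> G)) = P \<union> Q"
        unfolding P_def Q_def using i by auto
      finally have 1: "card (F \<union> G) + 1 \<le> k * card (P \<union> Q)"
        using F(1) G(1) finFG by (subst (asm) card_insert_disjoint) auto
      have "F \<inter> G \<subseteq> I" using F(1) by auto
      from less.prems(2)[OF this]
      have "card (F \<inter> G) \<le> k * card (\<Union>(A ` (F \<inter> G)))" .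
      also have "\<dots> \<le> k * card (P \<inter> Q)"
        using fin by (intro mult_le_mono2 card_mono) (auto simp: P_def Q_def)
      finally have 2: "card (F \<inter> G) \<le> k * card (P \<inter> Q)" .
      have "k * card P + k * card Q = k * card (P \<union> Q) + k * card (P \<inter> Q)"
        using card_Un_Int[OF fin] by (metis distrib_left)
      with 1 2 F(2) G(2) card_Un_Int[OF finFG] show False
        unfolding P_def[symmetric] Q_def[symmetric] by linarith
    qed
  qed
qed

section \<open>Multigraphs in which every edge is disjoint from few others\<close>

text \<open>
  If the total weight \<open>m\<close> exceeds \<open>5 B / 2\<close>, then summing the edge condition over the edges at a
  vertex shows that it has 3, 4 or 5 neighbours and that there are exactly 6 vertices. Summing over
  the set \<open>W\<close> of vertices that have a non-neighbour then shows that the graph is complete.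
\<close>
lemma weighted_graph_bound:
  fixes x :: "'a \<Rightarrow> 'a \<Rightarrow> real" and d :: "'a \<Rightarrow> real" and m B :: real
  assumes fin: "finite N" and B0: "B \<ge> 0"
    and nonneg: "\<And>u v. x u v \<ge> 0" and sym: "\<And>u v. x u v = x v u" and irrefl: "\<And>u. x u u = 0"
    and d: "\<And>u. u \<in> N \<Longrightarrow> d u = (\<Sum>v\<in>N. x u v)"
    and pos: "\<And>u. u \<in> N \<Longrightarrow> d u > 0" and le: "\<And>u. u \<in> N \<Longrightarrow> d u \<le> B"
    and total: "2 * m = (\<Sum>u\<in>N. d u)"
    and edge: "\<And>u v. u \<in> N \<Longrightarrow> v \<in> N \<Longrightarrow> x u v > 0 \<Longrightarrow> m - B \<le> d u + d v - x u v"
  shows "2 * m \<le> 5 * B"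
proof (rule ccontr)
  assume "\<not> ?thesis"
  then have big: "2 * m > 5 * B" by simp
  define nb where "nb u = {v\<in>N. x u v > 0}" for u
  define Q where "Q u = {v\<in>N. v \<noteq> u \<and> x u v = 0}" for u
  define k where "k u = card (nb u)" for u
  define q where "q u = card (Q u)" for u
  define R where "R u = (\<Sum>v\<in>Q u. d v)" for u
  have finQ: "finite (nb u)" "finite (Q u)" for u
    using fin by (auto simp: nb_def Q_def)
  have split: "N = insert u (nb u \<union> Q u)" "u \<notin> nb u \<union> Q u" "nb u \<inter> Q u = {}" if "u \<in> N" for u
    using that irrefl nonneg by (auto simp: nb_def Q_def less_le)
  have cardN: "card N = 1 + k u + q u" if "u \<in> N" for u
  proof -
    have "card N = Suc (card (nb u \<union> Q u))"
      using split[OF that] finQ by (metis card_insert_disjoint finite_UnI)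
    also have "card (nb u \<union> Q u) = k u + q u"
      unfolding k_def q_def using split[OF that] finQ by (simp add: card_Un_disjoint)
    finally show ?thesis by simp
  qed
  have sumN: "2 * m = d u + (\<Sum>v\<in>nb u. d v) + R u" if "u \<in> N" for u
  proof -
    have "2 * m = d u + (\<Sum>v\<in>nb u \<union> Q u. d v)"
      using split[OF that] finQ total by (metis finite_UnI sum.insert)
    also have "(\<Sum>v\<in>nb u \<union> Q u. d v) = (\<Sum>v\<in>nb u. d v) + R u"
      unfolding R_def using split[OF that] finQ by (simp add: sum.union_disjoint)
    finally show ?thesis by simp
  qed
  \<comment> \<open>Sum the edge condition over the neighbours of \<open>u\<close>; their weights
    \<open>x u v\<close> add up to \<open>d u\<close>.\<close>
  have ineq: "k u * (m - B) \<le> k u * d u - d u + (\<Sum>v\<in>nb u. d v)" if "u \<in> N" for u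
  proof -
    have "(\<Sum>v\<in>nb u. m - B) \<le> (\<Sum>v\<in>nb u. d u + d v - x u v)"
      using edge that by (intro sum_mono) (auto simp: nb_def)
    moreover have "(\<Sum>v\<in>nb u. x u v) = d u"
      unfolding d[OF that] nb_def using fin nonneg
      by (intro sum.mono_neutral_left) (auto simp: less_le)
    ultimately show ?thesis
      by (simp add: sum.distrib sum_subtractf k_def)
  qed
  \<comment> \<open>A neighbour \<open>v\<close> has \<open>d v \<le> B\<close>, so
    \<open>d u \<ge> m - 2 * B > B / 2\<close>.\<close>
  have half: "2 * d u > B" if u: "u \<in> N" for u
  proof -
    have "(\<Sum>v\<in>N. x u v) \<noteq> 0" using pos[OF u] d[OF u] by simp
    then obtain v where v: "v \<in> N" "x u v \<noteq> 0" by (meson sum.neutral)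
    with nonneg[of u v] have "x u v > 0" by simp
    from edge[OF u v(1) this] le[OF v(1)] this big show ?thesis by linarith
  qed
  have Bpos: "B > 0" if "u \<in> N" for u using pos[OF that] le[OF that] by linarith
  have k: "k u = 3 \<or> k u = 4 \<or> k u = 5" if u: "u \<in> N" for u
  proof -
    have "(\<Sum>v\<in>nb u. d v) \<le> (\<Sum>v\<in>nb u. B)"
      using le by (intro sum_mono) (auto simp: nb_def)
    then have s: "(\<Sum>v\<in>nb u. d v) \<le> k u * B" by (simp add: k_def)
    have R0: "R u \<ge> 0" unfolding R_def using pos by (intro sum_nonneg) (auto simp: Q_def less_imp_le)
    \<comment> \<open>Two neighbours would give \<open>2 * (m - B) \<le> 3 * B\<close>, which is the
      claimed bound; the blown-up \<open>C\<^sub>5\<close> attains it.\<close>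
    have lower: "k u \<ge> 3"
    proof (rule ccontr)
      assume "\<not> ?thesis"
      then consider "k u = 0" | "k u = 1" | "k u = 2" by linarith
      then show False
        using ineq[OF u] s le[OF u] big pos[OF u] by cases (auto simp: k_def)
    qed
    have "k u * (m - B) \<le> (real (k u) - 2) * d u + 2 * m"
      using ineq[OF u] sumN[OF u] R0 by (simp add: algebra_simps)
    also have "\<dots> \<le> (real (k u) - 2) * B + 2 * m"
      using lower le[OF u] by (intro add_right_mono mult_left_mono) auto
    finally have "(real (k u) - 2) * m \<le> (2 * real (k u) - 2) * B" by (simp add: algebra_simps)
    moreover have "(real (k u) - 2) * (5 * B) < (real (k u) - 2) * (2 * m)"
      using lower big by (intro mult_strict_left_mono) auto
    ultimately have "real (k u) * B < 6 * B" by (simp add: algebra_simps)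
    then have "k u < 6" using Bpos[OF u] by simp
    with lower show ?thesis by linarith
  qed
  have R: "R u \<ge> q u * (B / 2)" "q u > 0 \<Longrightarrow> R u > q u * (B / 2)" if "u \<in> N" for u
  proof -
    have h: "d v > B / 2" if "v \<in> Q u" for v using half[of v] that by (auto simp: Q_def)
    have "(\<Sum>v\<in>Q u. B / 2) \<le> R u"
      unfolding R_def using h by (intro sum_mono) (auto simp: less_imp_le)
    then show "R u \<ge> q u * (B / 2)" by (simp add: q_def)
    assume "q u > 0"
    then have "Q u \<noteq> {}" by (auto simp: q_def)
    then have "(\<Sum>v\<in>Q u. B / 2) < R u"
      unfolding R_def using h finQ by (intro sum_strict_mono) auto
    then show "R u > q u * (B / 2)" by (simp add: q_def)
  qed
  \<comment> \<open>Together, \<open>ineq\<close> and \<open>sumN\<close> give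
    \<open>R u \<le> k u * B + (k u - 2) * (d u - m)\<close>, which is less than
    \<open>(6 - k u) * B / 2\<close>. Non-neighbours have degree above \<open>B / 2\<close>, so
    \<open>q u < 6 - k u\<close>.\<close>
  have cardN_le: "card N \<le> 6" if u: "u \<in> N" for u
    using k[OF u]
  proof (elim disjE)
    assume a: "k u = 3"
    then have "R u < 3 * (B / 2)"
      using ineq[OF u] sumN[OF u] le[OF u] big by simp
    with R(1)[OF u] have "q u * (B / 2) < 3 * (B / 2)" by linarith
    with Bpos[OF u] have "q u < 3" by simp
    with cardN[OF u] a show ?thesis by simp
  next
    assume a: "k u = 4"
    then have "R u < 2 * (B / 2)"
      using ineq[OF u] sumN[OF u] le[OF u] big by simp
    with R(1)[OF u] have "q u * (B / 2) < 2 * (B / 2)" by linarith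
    with Bpos[OF u] have "q u < 2" by simp
    with cardN[OF u] a show ?thesis by simp
  next
    assume a: "k u = 5"
    then have "R u < 1 * (B / 2)"
      using ineq[OF u] sumN[OF u] le[OF u] big by simp
    with R(1)[OF u] have "q u * (B / 2) < 1 * (B / 2)" by linarith
    with Bpos[OF u] have "q u < 1" by simp
    with cardN[OF u] a show ?thesis by simp
  qed
  have six: "card N = 6"
  proof (cases "N = {}")
    case True
    with total big B0 show ?thesis by simp
  next
    case False
    then obtain u where u: "u \<in> N" by blast
    have "(\<Sum>v\<in>N. d v) \<le> (\<Sum>v\<in>N. B)" using le by (intro sum_mono)
    then have "2 * m \<le> card N * B" using total by simp
    with big have "5 * B < card N * B" by linarith
    with Bpos[OF u] have "card N > 5" by simp
    with cardN_le[OF u] show ?thesis by simp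
  qed
  \<comment> \<open>The same elimination with \<open>k u = 5 - q u\<close>, but keeping
    \<open>d u\<close> and using only \<open>m > 5 * B / 2\<close>.\<close>
  have Rd: "R u + (real (q u) - 3) * d u < (3 / 2 * real (q u) - 5 / 2) * B"
    if u: "u \<in> N" for u
    using k[OF u] cardN[OF u] six ineq[OF u] sumN[OF u] big by auto
  define W where "W = {u\<in>N. q u > 0}"
  have WQ: "Q u \<subseteq> W" if "u \<in> N" for u
  proof
    fix v assume v: "v \<in> Q u"
    then have "u \<in> Q v" using that sym by (auto simp: Q_def)
    then have "q v > 0" unfolding q_def using finQ by (metis card_gt_0_iff empty_iff)
    with v show "v \<in> W" by (auto simp: W_def Q_def)
  qed
  have finW: "finite W" and WN: "W \<subseteq> N" using fin by (auto simp: W_def)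
  have "W = {}"
  proof (rule ccontr)
    assume ne: "W \<noteq> {}"
    \<comment> \<open>Non-adjacency is symmetric, so \<open>d v\<close> is counted once for each of
      the \<open>q v\<close> non-neighbours of \<open>v\<close>.\<close>
    have "(\<Sum>u\<in>W. R u) = (\<Sum>u\<in>W. \<Sum>v\<in>W. if v \<in> Q u then d v else 0)"
    proof (rule sum.cong)
      fix u assume "u \<in> W"
      then have "W \<inter> Q u = Q u" using WQ WN by blast
      then show "R u = (\<Sum>v\<in>W. if v \<in> Q u then d v else 0)"
        unfolding R_def using sum.inter_restrict[OF finW, of d "Q u"] by simp
    qed simp
    also have "\<dots> = (\<Sum>v\<in>W. \<Sum>u\<in>W. if v \<in> Q u then d v else 0)"
      by (rule sum.swap)
    also have "\<dots> = (\<Sum>v\<in>W. q v * d v)"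
    proof (rule sum.cong)
      fix v assume v: "v \<in> W"
      have "(\<Sum>u\<in>W. if v \<in> Q u then d v else 0) = (\<Sum>u\<in>W. if u \<in> Q v then d v else 0)"
        using v WN sym by (intro sum.cong) (auto simp: Q_def)
      also have "\<dots> = (\<Sum>u\<in>W \<inter> Q v. d v)"
        using sum.inter_restrict[OF finW, of "\<lambda>_. d v" "Q v"] by simp
      also have "W \<inter> Q v = Q v" using WQ WN v by blast
      finally show "(\<Sum>u\<in>W. if v \<in> Q u then d v else 0) = q v * d v"
        by (simp add: q_def)
    qed simp
    finally have swap: "(\<Sum>u\<in>W. R u) = (\<Sum>v\<in>W. q v * d v)" .
    have "(\<Sum>u\<in>W. R u + (real (q u) - 3) * d u) < (\<Sum>u\<in>W. (3 / 2 * real (q u) - 5 / 2) * B)"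
      using finW ne Rd WN by (intro sum_strict_mono) auto
    also have "\<dots> \<le> (\<Sum>u\<in>W. (2 * real (q u) - 3) * d u)"
    proof (rule sum_mono)
      fix u assume "u \<in> W"
      then have u: "u \<in> N" "q u > 0" by (auto simp: W_def)
      \<comment> \<open>Here \<open>k u \<ge> 3\<close> and \<open>card N = 6\<close> force
        \<open>q u \<le> 2\<close>. The two cases reduce to \<open>d u \<le> B\<close> and
        \<open>B / 2 \<le> d u\<close>.\<close>
      then consider "q u = 1" | "q u = 2" using k[OF u(1)] cardN[OF u(1)] six by fastforce
      then show "(3 / 2 * real (q u) - 5 / 2) * B \<le> (2 * real (q u) - 3) * d u"
        using half[OF u(1)] le[OF u(1)] by cases auto
    qed
    also have "\<dots> = (\<Sum>u\<in>W. q u * d u) + (\<Sum>u\<in>W. (real (q u) - 3) * d u)"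
      by (simp add: sum.distrib[symmetric] algebra_simps)
    also have "\<dots> = (\<Sum>u\<in>W. R u + (real (q u) - 3) * d u)"
      by (simp add: swap sum.distrib)
    finally show False by simp
  qed
  then have q0: "q u = 0" if "u \<in> N" for u using that by (auto simp: W_def)
  \<comment> \<open>All six vertices now have five neighbours; the sum reads
    \<open>18 * m \<le> 6 * m + 30 * B\<close>.\<close>
  have "(\<Sum>u\<in>N. 3 * m) \<le> (\<Sum>u\<in>N. 3 * d u + 5 * B)"
  proof (rule sum_mono)
    fix u assume u: "u \<in> N"
    have "k u = 5" using cardN[OF u] six q0[OF u] by simp
    then show "3 * m \<le> 3 * d u + 5 * B"
      using ineq[OF u] sumN[OF u] R(1)[OF u] q0[OF u] by simp
  qed
  also have "\<dots> = 6 * m + 30 * B"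
    by (simp add: sum.distrib sum_distrib_left[symmetric] total[symmetric] six)
  finally show False using big six by simp
qed


lemma sum_card_incidence:
  assumes "finite I" "finite N" "\<And>i. i \<in> I \<Longrightarrow> P i \<subseteq> N" "\<And>i. i \<in> I \<Longrightarrow> card (P i) = c"
  shows "(\<Sum>v\<in>N. card {i\<in>I. v \<in> P i}) = c * card I"
proof -
  have "(\<Sum>v\<in>N. card {i\<in>I. v \<in> P i}) = (\<Sum>i\<in>I. card {v\<in>N. v \<in> P i})"
    using assms(1,2) by (intro sum_multicount_gen) auto
  also have "\<dots> = (\<Sum>i\<in>I. c)"
  proof (rule sum.cong)
    fix i assume i: "i \<in> I"
    then have "{v\<in>N. v \<in> P i} = P i" using assms(3) by blast
    then show "card {v\<in>N. v \<in> P i} = c" using assms(4)[OF i] by simp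
  qed simp
  finally show ?thesis by simp
qed

text \<open>Every \<open>P j\<close> avoids \<open>P i\<close> or contains \<open>u\<close> or
  \<open>v\<close>; inclusion-exclusion counts the latter. The case \<open>u = v\<close> is allowed
  and covers singletons.\<close>

lemma card_le_degrees_of_edge:
  fixes P :: "'b \<Rightarrow> 'a set"
  assumes "finite I" "P i = {u, v}" "card {j\<in>I. P i \<inter> P j = {}} \<le> B"
  shows "card I + card {j\<in>I. {u, v} \<subseteq> P j}
    \<le> B + card {j\<in>I. u \<in> P j} + card {j\<in>I. v \<in> P j}"
proof -
  let ?U = "{j\<in>I. u \<in> P j}" and ?V = "{j\<in>I. v \<in> P j}" and ?D = "{j\<in>I. P i \<inter> P j = {}}"
  have fin: "finite ?U" "finite ?V" "finite ?D" using assms(1) by auto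
  have "P i \<inter> P j = {} \<or> u \<in> P j \<or> v \<in> P j" for j
    unfolding assms(2) by blast
  then have "I \<subseteq> ?D \<union> (?U \<union> ?V)" by blast
  then have "card I \<le> card (?D \<union> (?U \<union> ?V))"
    using fin by (intro card_mono finite_UnI)
  also have "\<dots> \<le> card ?D + card (?U \<union> ?V)" by (rule card_Un_le)
  finally have "card I \<le> card ?D + card (?U \<union> ?V)" .
  moreover have "?U \<inter> ?V = {j\<in>I. {u, v} \<subseteq> P j}" by auto
  ultimately show ?thesis using card_Un_Int[OF fin(1,2)] assms(3) by simp
qed

text \<open>Indices keep parallel edges apart; their multiplicities serve as weights in
  \<open>weighted_graph_bound\<close>.\<close>

lemma multigraph_bound:
  fixes P :: "'b \<Rightarrow> 'a set"
  assumes fin: "finite I" and two: "\<And>i. i \<in> I \<Longrightarrow> card (P i) = 2"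
    and deg: "\<And>v. card {i\<in>I. v \<in> P i} \<le> B"
    and disj: "\<And>i. i \<in> I \<Longrightarrow> card {j\<in>I. P i \<inter> P j = {}} \<le> B"
  shows "2 * card I \<le> 5 * B"
proof -
  define N where "N = \<Union>(P ` I)"
  define x where "x u v = card {i\<in>I. P i = {u, v}}" for u v
  define d where "d u = card {i\<in>I. u \<in> P i}" for u
  have finP: "finite (P i)" if "i \<in> I" for i using two[OF that] card.infinite by fastforce
  have finN: "finite N" unfolding N_def using fin finP by auto
  have pair: "{u, v} \<subseteq> P i \<longleftrightarrow> P i = {u, v}" if "i \<in> I" "u \<noteq> v" for i u v
    using card_subset_eq[OF finP[OF that(1)], of "{u, v}"] two[OF that(1)] that(2) by auto
  have irrefl: "x u u = 0" for u
  proof -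
    have "{i\<in>I. P i = {u, u}} = {}" using two by fastforce
    then show ?thesis by (simp only: x_def card.empty)
  qed
  have d_sum: "d u = (\<Sum>v\<in>N. x u v)" if "u \<in> N" for u
  proof -
    let ?I = "{i\<in>I. u \<in> P i}"
    have "{i\<in>?I. v \<in> P i - {u}} = (if v = u then {} else {i\<in>I. P i = {u, v}})" for v
      using pair by auto
    then have "x u v = card {i\<in>?I. v \<in> P i - {u}}" for v
      using irrefl by (auto simp: x_def)
    moreover have "(\<Sum>v\<in>N. card {i\<in>?I. v \<in> P i - {u}}) = 1 * card ?I"
      using fin finN two finP by (intro sum_card_incidence) (auto simp: N_def)
    ultimately show ?thesis by (simp add: d_def)
  qed
  have "2 * real (card I) \<le> 5 * real B"
  proof (rule weighted_graph_bound[where N = N and x = "\<lambda>u v. real (x u v)" and d = "\<lambda>u. real (d u)"])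
    show "real (x u v) = real (x v u)" for u v by (simp add: x_def insert_commute)
    show "real (d u) > 0" if "u \<in> N" for u
      using that fin by (auto simp: N_def d_def card_gt_0_iff)
    have "(\<Sum>u\<in>N. d u) = 2 * card I"
      unfolding d_def using fin finN two by (intro sum_card_incidence) (auto simp: N_def)
    then show "2 * real (card I) = (\<Sum>u\<in>N. real (d u))"
      by (simp flip: of_nat_sum)
    show "real (card I) - real B \<le> real (d u) + real (d v) - real (x u v)"
      if "real (x u v) > 0" for u v
    proof -
      from that have "card {i\<in>I. P i = {u, v}} \<noteq> 0" by (simp add: x_def)
      then have "{i\<in>I. P i = {u, v}} \<noteq> {}" by (metis card.empty)
      then obtain i where i: "i \<in> I" "P i = {u, v}" by blast
      have "u \<noteq> v" using that irrefl by auto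
      then have "{j\<in>I. {u, v} \<subseteq> P j} = {j\<in>I. P j = {u, v}}" using pair by auto
      then show ?thesis
        using card_le_degrees_of_edge[OF fin i(2) disj[OF i(1)]] by (simp add: d_def x_def)
    qed
    show "real (d u) \<le> real B" for u using deg by (simp add: d_def)
    show "real (d u) = (\<Sum>v\<in>N. real (x u v))" if "u \<in> N" for u
      using d_sum[OF that] by simp
  qed (use finN irrefl in auto)
  then show ?thesis by linarith
qed

section \<open>Cliques in the square of an oriented graph\<close>

lemma oriented_square_clique_bound:
  fixes out :: "'a \<Rightarrow> 'a set"
  assumes finK: "finite K" and fin_out: "\<And>v. finite (out v)"
    and out2: "\<And>v. card (out v) \<le> 2"
    and fin_in: "\<And>v. finite {u. v \<in> out u}" and in_le: "\<And>v. card {u. v \<in> out u} \<le> D"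
    and clique: "\<And>u v. u \<in> K \<Longrightarrow> v \<in> K \<Longrightarrow> u \<noteq> v \<Longrightarrow> u \<in> out v \<or> v \<in> out u \<or>
      (\<exists>w. (u \<in> out w \<or> w \<in> out u) \<and> (v \<in> out w \<or> w \<in> out v))"
  shows "2 * card K \<le> 5 * D + 1064"
proof (rule ccontr)
  assume "\<not> ?thesis"
  then have large: "2 * card K > 5 * D + 1064" by simp
  \<comment> \<open>The ends of directed paths of length 1 or 2 from \<open>u\<close>.\<close>
  define S where "S u = out u \<union> \<Union>(out ` out u)" for u
  \<comment> \<open>The threshold 59 makes \<open>|X| \<le> |K| / 10\<close> for the smallest admissible \<open>X\<close>, hence
      \<open>|K - X|\<close> exceeds \<open>2 B\<close> by a linear amount.\<close>
  define adm where "adm X \<longleftrightarrow> X \<subseteq> K \<and> (\<forall>v\<in>K - X. card {u\<in>K. v \<in> S u} \<le> 59)" for X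
  \<comment> \<open>In \<open>disj\<close>, 66 = 1 + 6 + 59 bounds \<open>{v}\<close>,
    \<open>S v\<close> and \<open>?T\<close>, while \<open>D\<close> bounds
    \<open>?W\<close>.\<close>
  define B where "B = D + 66"
  have finS: "finite (S u)" for u unfolding S_def using fin_out by auto
  have cardS: "card (S u) \<le> 6" for u
  proof -
    have "card (S u) \<le> card (out u) + card (\<Union>(out ` out u))"
      unfolding S_def by (rule card_Un_le)
    also have "card (\<Union>(out ` out u)) \<le> 2 * card (out u)"
      using fin_out out2 by (intro card_UN_le_mult) auto
    finally show ?thesis using out2[of u] by linarith
  qed
  have many: "60 * card {v\<in>K. card {u\<in>Y. v \<in> S u} > 59} \<le> 6 * card Y" if "Y \<subseteq> K" for Y
  proof -
    let ?M = "{v\<in>K. card {u\<in>Y. v \<in> S u} > 59}"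
    have finY: "finite Y" using that finK finite_subset by blast
    have "60 * card ?M = (\<Sum>v\<in>?M. 60)" by simp
    also have "\<dots> \<le> (\<Sum>v\<in>?M. card {u\<in>Y. v \<in> S u})" by (intro sum_mono) auto
    also have "\<dots> = (\<Sum>u\<in>Y. card {v\<in>?M. v \<in> S u})"
      using finK finY by (intro sum_multicount_gen) auto
    also have "\<dots> \<le> (\<Sum>u\<in>Y. 6)"
    proof (rule sum_mono)
      fix u
      have "card {v\<in>?M. v \<in> S u} \<le> card (S u)" by (intro card_mono finS) auto
      with cardS[of u] show "card {v\<in>?M. v \<in> S u} \<le> 6" by linarith
    qed
    finally show ?thesis by simp
  qed
  have "adm {v\<in>K. card {u\<in>K. v \<in> S u} > 59}" by (auto simp: adm_def)
  from ex_has_least_nat[of adm, OF this, of card]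
  obtain X where X: "adm X" and X_min: "\<And>Y. adm Y \<Longrightarrow> card X \<le> card Y" by blast
  have XK: "X \<subseteq> K" using X by (simp add: adm_def)
  then have finX: "finite X" using finK finite_subset by blast
  have "60 * card X \<le> 6 * card K"
    using X_min[OF \<open>adm {v\<in>K. card {u\<in>K. v \<in> S u} > 59}\<close>] many[OF order_refl] by linarith
  define I where "I = K - X"
  have finI: "finite I" using finK by (simp add: I_def)
  have cardI: "card I + card X = card K"
    unfolding I_def using XK finK by (simp add: card_Diff_subset finX card_mono)
  \<comment> \<open>Equivalent to \<open>19 * (card I - 2 * B) > 2 * card I\<close>, which will
    exclude 19 vertices in \<open>H\<close>.\<close>
  have IB: "17 * card I > 38 * B"
    using \<open>60 * card X \<le> 6 * card K\<close> cardI large by (simp add: B_def)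
  have disj: "card {u\<in>I. out v \<inter> out u = {}} \<le> B" if v: "v \<in> I" for v
  proof -
    let ?T = "{u\<in>K. v \<in> S u}" and ?W = "\<Union>w\<in>{w. v \<in> out w}. out w - {v}"
    \<comment> \<open>Disjointness excludes a common out-neighbour; the other orientations of a
      linking path land in \<open>S v\<close>, \<open>?T\<close> or \<open>?W\<close>. The set
      \<open>{v}\<close> covers an empty \<open>out v\<close>, still possible here.\<close>
    have "{u\<in>I. out v \<inter> out u = {}} \<subseteq> {v} \<union> S v \<union> ?T \<union> ?W"
    proof
      fix u assume u: "u \<in> {u\<in>I. out v \<inter> out u = {}}"
      show "u \<in> {v} \<union> S v \<union> ?T \<union> ?W"
      proof (cases "u = v")
        case False
        from u v have uv: "u \<in> K" "v \<in> K" "out v \<inter> out u = {}" by (auto simp: I_def)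
        from clique[OF uv(1,2) False] uv(3) consider "u \<in> S v" | "v \<in> S u"
          | w where "v \<in> out w" "u \<in> out w"
          unfolding S_def by (elim disjE exE conjE) auto
        then show ?thesis using uv(1) False by cases auto
      qed simp
    qed
    then have "card {u\<in>I. out v \<inter> out u = {}} \<le> card ({v} \<union> S v \<union> ?T \<union> ?W)"
      using finS finK fin_in fin_out by (intro card_mono) auto
    also have "\<dots> \<le> card ({v} \<union> S v \<union> ?T) + card ?W" by (rule card_Un_le)
    also have "card ({v} \<union> S v \<union> ?T) \<le> card ({v} \<union> S v) + card ?T" by (rule card_Un_le)
    also have "card ({v} \<union> S v) \<le> card {v} + card (S v)" by (rule card_Un_le)
    also have "card ?T \<le> 59" using X v by (auto simp: adm_def I_def)
    also have "card ?W \<le> 1 * card {w. v \<in> out w}"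
    proof (rule card_UN_le_mult[OF fin_in])
      fix w assume "w \<in> {w. v \<in> out w}"
      then show "card (out w - {v}) \<le> 1" using out2[of w] fin_out[of w] by simp
    qed
    finally show ?thesis using cardS[of v] in_le[of v] by (simp add: B_def)
  qed
  have deg: "card {u\<in>I. w \<in> out u} \<le> B" for w
  proof -
    have "card {u\<in>I. w \<in> out u} \<le> card {u. w \<in> out u}"
      by (intro card_mono fin_in) auto
    with in_le[of w] show ?thesis by (simp add: B_def)
  qed
  have two: "card (out v) = 2" if v: "v \<in> I" for v
  proof (rule ccontr)
    assume "card (out v) \<noteq> 2"
    then have "card (out v) \<le> 1" using out2[of v] by linarith
    then consider "out v = {}" | w where "out v = {w}"
      using fin_out by (metis card_0_eq card_1_singletonE le_Suc_eq le_zero_eq One_nat_def)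
    then show False
    proof cases
      case 1
      with disj[OF v] IB show False by simp
    next
      case (2 w)
      with card_le_degrees_of_edge[of I out v w w B] finI disj[OF v] deg[of w] IB
      show False by simp
    qed
  qed
  define H where "H = \<Union>(out ` I)"
  have finH: "finite H" unfolding H_def using finI fin_out by auto
  \<comment> \<open>At least \<open>card I - B\<close> edges meet an edge \<open>{p, q}\<close>, and
    at most \<open>B\<close> of them contain \<open>q\<close>.\<close>
  have hub: "card I - 2 * B \<le> card {u\<in>I. p \<in> out u}" if "p \<in> H" for p
  proof -
    from that obtain v where v: "v \<in> I" "p \<in> out v" by (auto simp: H_def)
    with two[OF v(1)] obtain q where "out v = {p, q}"
      by (metis card_2_iff insert_commute insert_iff singletonD)
    from card_le_degrees_of_edge[of I out, OF finI this disj[OF v(1)]] deg[of q]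
    show ?thesis by linarith
  qed
  have "card H * (card I - 2 * B) = (\<Sum>p\<in>H. card I - 2 * B)" by simp
  also have "\<dots> \<le> (\<Sum>p\<in>H. card {u\<in>I. p \<in> out u})" using hub by (rule sum_mono)
  also have "\<dots> = 2 * card I"
    using finI finH two by (intro sum_card_incidence) (auto simp: H_def)
  finally have HI: "card H * (card I - 2 * B) \<le> 2 * card I" .
  have H18: "card H \<le> 18"
  proof (rule ccontr)
    assume "\<not> ?thesis"
    then have "19 * (card I - 2 * B) \<le> card H * (card I - 2 * B)" by (intro mult_le_mono1) simp
    with HI IB show False by linarith
  qed
  define Z where "Z = H \<union> \<Union>(out ` H)"
  have "card Z \<le> card H + card (\<Union>(out ` H))" unfolding Z_def by (rule card_Un_le)
  also have "card (\<Union>(out ` H)) \<le> 2 * card H" using finH out2 by (intro card_UN_le_mult) auto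
  finally have Z54: "card Z \<le> 54" using H18 by linarith
  have finZ: "finite Z" unfolding Z_def using finH fin_out by auto
  let ?Y = "{v\<in>K. card {u\<in>X. v \<in> S u} > 59}"
  \<comment> \<open>Paths from \<open>I\<close> end in \<open>Z\<close>, so outside \<open>Z\<close>
    only paths from \<open>X\<close> count, and \<open>?Y\<close> collects the vertices receiving
    too many of these.\<close>
  have "adm ((Z \<inter> K) \<union> ?Y)"
    unfolding adm_def
  proof (intro conjI ballI)
    fix v assume v: "v \<in> K - (Z \<inter> K \<union> ?Y)"
    have "S u \<subseteq> Z" if "u \<in> I" for u
      using that by (auto simp: S_def Z_def H_def)
    then have "{u\<in>K. v \<in> S u} = {u\<in>X. v \<in> S u}" using v XK by (auto simp: I_def)
    with v show "card {u\<in>K. v \<in> S u} \<le> 59" by (simp add: not_less)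
  qed auto
  then have "card X \<le> card (Z \<inter> K \<union> ?Y)" by (rule X_min)
  also have "\<dots> \<le> card (Z \<inter> K) + card ?Y" by (rule card_Un_le)
  also have "card (Z \<inter> K) \<le> card Z" using finZ by (intro card_mono) auto
  \<comment> \<open>By \<open>many\<close>, \<open>card ?Y \<le> card X / 10\<close>, hence
    \<open>card X \<le> 54 + card X / 10\<close>.\<close>
  finally have "card X \<le> 60" using Z54 many[OF XK] by linarith
  moreover have "2 * card I \<le> 5 * B" using multigraph_bound[OF finI two deg disj] .
  \<comment> \<open>Altogether
    \<open>2 * card K \<le> 5 * (D + 66) + 120 = 5 * D + 450\<close>.\<close>
  ultimately show False using cardI large by (simp add: B_def)
qed

section \<open>Orienting a graph of maximum average degree below 4\<close>

lemma card_edges_le_of_mad_lt_4: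
  assumes "graph V E" "mad V E < 4" "F \<subseteq> E"
  shows "card F \<le> 2 * card (\<Union>F)"
proof (cases "F = {}")
  case False
  let ?A = "{2 * real (card F) / real (card S) | S F.
            S \<subseteq> V \<and> S \<noteq> {} \<and> F \<subseteq> E \<and> (\<forall>e\<in>F. e \<subseteq> S)}"
  have V: "finite V" "\<And>e. e \<in> E \<Longrightarrow> e \<subseteq> V" "\<And>e. e \<in> E \<Longrightarrow> e \<noteq> {}"
    using assms(1) by (auto simp: graph_def)
  have S: "\<Union>F \<subseteq> V" "\<Union>F \<noteq> {}" using assms(3) V False by blast+
  have "finite E" using V by (meson PowI finite_Pow_iff finite_subset subsetI)
  have "?A \<subseteq> (\<lambda>(S, F). 2 * real (card F) / real (card S)) ` (Pow V \<times> Pow E)" by auto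
  \<comment> \<open>Finiteness makes \<open>Max\<close> an upper bound for the ratio of the subgraph
    formed by \<open>F\<close> and the vertices it covers.\<close>
  then have "finite ?A" using V(1) \<open>finite E\<close> by (meson finite_Pow_iff finite_SigmaI finite_imageI finite_subset)
  moreover have "2 * real (card F) / real (card (\<Union>F)) \<in> ?A"
    using S assms(3) by blast
  ultimately have "2 * real (card F) / real (card (\<Union>F)) \<le> Max ?A" by (rule Max_ge)
  also have "\<dots> = mad V E" using S by (auto simp: mad_def)
  finally have "2 * real (card F) / real (card (\<Union>F)) < 4" using assms(2) by simp
  moreover have "card (\<Union>F) > 0" using S V(1) finite_subset by (auto simp: card_gt_0_iff)
  ultimately have "2 * real (card F) < 4 * real (card (\<Union>F))" by (simp add: divide_less_eq)
  then show ?thesis by linarith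
qed simp

theorem theorem2:
  fixes V :: "'a set" and E :: "'a set set" and D :: nat
  assumes "D > 0"
    and "graph V E"
    and "mad V E < 4"
    and "max_degree V E \<le> D"
  shows "real (clique_number V (square_edges V E)) \<le> 5 / 2 * real D + 532"
proof -
  have V: "finite V" and E: "\<And>e. e \<in> E \<Longrightarrow> e \<subseteq> V \<and> card e = 2"
    using assms(2) by (auto simp: graph_def)
  have finE: "finite E" using V E by (meson PowI finite_Pow_iff finite_subset subsetI)
  have fin_e: "finite e" if "e \<in> E" for e using V E[OF that] finite_subset by blast
  \<comment> \<open>Each edge chooses one of its ends as tail, no vertex being chosen more than
    twice; the sparsity bound is Hall's condition with capacity 2.\<close>
  obtain tail where tail: "\<forall>e\<in>E. tail e \<in> e" and tail2: "\<And>v. card {e\<in>E. tail e = v} \<le> 2"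
    using capacitated_representatives[OF finE, of "\<lambda>e. e" 2]
      card_edges_le_of_mad_lt_4[OF assms(2,3)] fin_e by auto
  define out where "out v = {w. {v, w} \<in> E \<and> tail {v, w} = v}" for v
  have edge: "v \<in> out u \<or> u \<in> out v" if "{u, v} \<in> E" for u v
    using tail that by (auto simp: out_def insert_commute)
  have inj: "inj_on (\<lambda>w. {v, w}) A" for v :: 'a and A by (auto simp: inj_on_def doubleton_eq_iff)
  have fin_out: "finite (out v)" and out2: "card (out v) \<le> 2" for v
  proof -
    have sub: "(\<lambda>w. {v, w}) ` out v \<subseteq> {e\<in>E. tail e = v}" by (auto simp: out_def)
    show "finite (out v)"
      using finite_subset[OF sub] finE finite_image_iff[OF inj] by auto
    have "card (out v) \<le> card {e\<in>E. tail e = v}"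
      using finE by (intro card_inj_on_le[OF inj sub]) auto
    with tail2[of v] show "card (out v) \<le> 2" by linarith
  qed
  \<comment> \<open>The oriented bound quantifies over the whole type; outside \<open>V\<close> the
    degree is 0.\<close>
  have degree: "card {e\<in>E. v \<in> e} \<le> D" for v
  proof (cases "v \<in> V")
    case True
    then have "degree E v \<le> max_degree V E"
      using V by (auto simp: max_degree_def)
    with assms(4) show ?thesis by (simp add: degree_def)
  next
    case False
    then have "{e\<in>E. v \<in> e} = {}" using E by auto
    then show ?thesis by (simp only: card.empty)
  qed
  have fin_in: "finite {u. v \<in> out u}" and in_le: "card {u. v \<in> out u} \<le> D" for v
  proof -
    have sub: "(\<lambda>w. {v, w}) ` {u. v \<in> out u} \<subseteq> {e\<in>E. v \<in> e}"
      by (auto simp: out_def insert_commute)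
    show "finite {u. v \<in> out u}"
      using finite_subset[OF sub] finE finite_image_iff[OF inj] by auto
    have "card {u. v \<in> out u} \<le> card {e\<in>E. v \<in> e}"
      using finE by (intro card_inj_on_le[OF inj sub]) auto
    with degree[of v] show "card {u. v \<in> out u} \<le> D" by linarith
  qed
  have bound: "2 * card K \<le> 5 * D + 1064" if K: "is_clique V (square_edges V E) K" for K
  proof (rule oriented_square_clique_bound[of K out])
    show "finite K" using K V finite_subset by (auto simp: is_clique_def)
    fix u v assume "u \<in> K" "v \<in> K" "u \<noteq> v"
    then have "{u, v} \<in> square_edges V E" using K by (auto simp: is_clique_def)
    then have "{u, v} \<in> E \<or> (\<exists>w. {u, w} \<in> E \<and> {w, v} \<in> E)"
      by (auto simp: square_edges_def doubleton_eq_iff insert_commute)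
    then show "u \<in> out v \<or> v \<in> out u \<or>
      (\<exists>w. (u \<in> out w \<or> w \<in> out u) \<and> (v \<in> out w \<or> w \<in> out v))"
      using edge by blast
  qed (use fin_out out2 fin_in in_le in auto)
  have "{K. is_clique V (square_edges V E) K} \<subseteq> Pow V" by (auto simp: is_clique_def)
  then have "finite {K. is_clique V (square_edges V E) K}" using V finite_subset by auto
  \<comment> \<open>The empty clique ensures that \<open>Max\<close> is attained.\<close>
  moreover have "is_clique V (square_edges V E) {}" by (simp add: is_clique_def)
  ultimately have "clique_number V (square_edges V E) \<in> card ` {K. is_clique V (square_edges V E) K}"
    unfolding clique_number_def by (intro Max_in) auto
  then have "2 * clique_number V (square_edges V E) \<le> 5 * D + 1064" using bound by auto
  then show ?thesis by linarith
qed

end
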